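(* Let $G$ and $H$ be graphs and let $G\oplus H$ be a clique sum of $G$ and $H$. Then $$\varepsilon(G \oplus H) = \max\{\varepsilon(G), \varepsilon(H)\}.$$
   Context: Graphs are finite, simple, undirected, with at least one vertex. For a graph $G$ with vertex set $[n]$, $\mathrm{Sym}(G)=\mathbb{R}^{V(G)+E(G)}$ is the space of partially specified symmetric $n\times n$ real matrices: $A\in\mathrm{Sym}(G)$ specifies the diagonal entries $A_{ii}$ and the entries $A_{ij}=A_{ji}$ for $\{i,j\}\in E(G)$, the others being unspecified. $\mathrm{tr}(A)=\sum_i A_{ii}$, and $I_n$ also denotes the image of the identity matrix in $\mathrm{Sym}(G)$ (diagonal entries $1$, edge entries $0$). $\Sigma(G)$ is the set of $A\in\mathrm{Sym}(G)$ for which there is a real symmetric positive semidefinite (PSD) $n\times n$ matrix agreeing with $A$ on all specified entries. $\mathcal{P}(G)$ is the set of $A\in \mathrm{Sym}(G)$ such that for every maximal clique $K$ of $G$ the (fully specified) principal submatrix of $A$ indexed by $K$ is PSD. $\bar{\mathcal{P}}(G)=\{A\in\mathcal{P}(G):\mathrm{tr}(A)=1\}$. The conical distance $\varepsilon(G)$ is the smallest real $\varepsilon\ge 0$ such that $M+\varepsilon I_n\in\Sigma(G)$ for all $M\in\bar{\mathcal{P}}(G)$. Clique sum: given a complete graph $K$ (possibly empty) and injective graph homomorphisms $\phi:K\to G$, $\psi:K\to H$, the clique sum $G\oplus H$ (with respect to $\phi,\psi$) is obtained from the disjoint union of $G$ and $H$ by identifying $\phi(x)$ with $\psi(x)$ for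 each vertex $x$ of $K$ (no edges are deleted). *)

theory Defs
  imports "HOL-Analysis.Analysis" "HOL-Library.Ramsey"
begin

section \<open>Graphs\<close>

record 'a ugraph =
  verts :: "'a set"
  edges :: "'a set set"

text \<open>The empty graph is allowed here: it is a possible gluing graph of a clique sum.\<close>

definition simple_graph :: "'a ugraph \<Rightarrow> bool" where
  "simple_graph G \<longleftrightarrow> finite (verts G) \<and> edges G \<subseteq> [verts G]\<^bsup>2\<^esup>"

definition complete_graph :: "'a ugraph \<Rightarrow> bool" where
  "complete_graph G \<longleftrightarrow> finite (verts G) \<and> edges G = [verts G]\<^bsup>2\<^esup>"

definition graph_clique :: "'a ugraph \<Rightarrow> 'a set \<Rightarrow> bool" where
  "graph_clique G C \<longleftrightarrow> C \<subseteq> verts G \<and> clique C (edges G)"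

definition maximal_clique :: "'a ugraph \<Rightarrow> 'a set \<Rightarrow> bool" where
  "maximal_clique G C \<longleftrightarrow>
     graph_clique G C \<and> (\<forall>D. graph_clique G D \<and> C \<subseteq> D \<longrightarrow> D = C)"

definition graph_hom :: "'a ugraph \<Rightarrow> 'b ugraph \<Rightarrow> ('a \<Rightarrow> 'b) \<Rightarrow> bool" where
  "graph_hom G H f \<longleftrightarrow> f ` verts G \<subseteq> verts H \<and> (\<forall>e\<in>edges G. f ` e \<in> edges H)"

section \<open>Clique sums\<close>

text \<open>
  The sum of \<open>G\<close> and \<open>H\<close> along \<open>\<phi>\<close> and \<open>\<psi>\<close> is the quotient of their disjoint union by the
  equivalence relation generated by identifying \<open>\<phi> x\<close> with \<open>\<psi> x\<close>; its vertices are the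
  equivalence classes.
\<close>

definition glued :: "'c ugraph \<Rightarrow> ('c \<Rightarrow> 'a) \<Rightarrow> ('c \<Rightarrow> 'b) \<Rightarrow> 'a + 'b \<Rightarrow> 'a + 'b \<Rightarrow> bool" where
  "glued K \<phi> \<psi> u v \<longleftrightarrow> (\<exists>x\<in>verts K. u = Inl (\<phi> x) \<and> v = Inr (\<psi> x))"

definition glue_class :: "'c ugraph \<Rightarrow> ('c \<Rightarrow> 'a) \<Rightarrow> ('c \<Rightarrow> 'b) \<Rightarrow> 'a + 'b \<Rightarrow> ('a + 'b) set" where
  "glue_class K \<phi> \<psi> u = {v. equivclp (glued K \<phi> \<psi>) u v}"

definition clique_sum ::
  "'c ugraph \<Rightarrow> ('c \<Rightarrow> 'a) \<Rightarrow> ('c \<Rightarrow> 'b) \<Rightarrow> 'a ugraph \<Rightarrow> 'b ugraph \<Rightarrow> ('a + 'b) set ugraph" where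
  "clique_sum K \<phi> \<psi> G H =
     \<lparr>verts = glue_class K \<phi> \<psi> ` (verts G <+> verts H),
      edges = (\<lambda>e. glue_class K \<phi> \<psi> ` Inl ` e) ` edges G \<union>
              (\<lambda>e. glue_class K \<phi> \<psi> ` Inr ` e) ` edges H\<rparr>"

section \<open>Partially specified symmetric matrices\<close>

text \<open>
  A partial matrix is a family indexed by the disjoint union of vertices and edges:
  \<open>A (Inl i)\<close> is the diagonal entry at \<open>i\<close> and \<open>A (Inr {i, j})\<close> is the entry at the edge
  \<open>{i, j}\<close>. Extensionality makes the families outside of this index set irrelevant.
\<close>

type_synonym 'a partial_matrix = "'a + 'a set \<Rightarrow> real"

definition Sym :: "'a ugraph \<Rightarrow> 'a partial_matrix set" where
  "Sym G = extensional (verts G <+> edges G)"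

text \<open>Meaningful only if \<open>i = j\<close> is a vertex or \<open>{i, j}\<close> is an edge.\<close>

definition entry :: "'a partial_matrix \<Rightarrow> 'a \<Rightarrow> 'a \<Rightarrow> real" where
  "entry A i j = (if i = j then A (Inl i) else A (Inr {i, j}))"

definition ptrace :: "'a ugraph \<Rightarrow> 'a partial_matrix \<Rightarrow> real" where
  "ptrace G A = (\<Sum>i\<in>verts G. A (Inl i))"

definition id_partial :: "'a ugraph \<Rightarrow> 'a partial_matrix" where
  "id_partial G = restrict (case_sum (\<lambda>i. 1) (\<lambda>e. 0)) (verts G <+> edges G)"

definition add_partial ::
  "'a ugraph \<Rightarrow> 'a partial_matrix \<Rightarrow> 'a partial_matrix \<Rightarrow> 'a partial_matrix" where
  "add_partial G A B = (\<lambda>s\<in>verts G <+> edges G. A s + B s)"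

definition scale_partial :: "'a ugraph \<Rightarrow> real \<Rightarrow> 'a partial_matrix \<Rightarrow> 'a partial_matrix" where
  "scale_partial G c A = (\<lambda>s\<in>verts G <+> edges G. c * A s)"

text \<open>Only the rows and columns of \<open>B\<close> indexed by \<open>S\<close> matter.\<close>

definition psd_on :: "'a set \<Rightarrow> ('a \<Rightarrow> 'a \<Rightarrow> real) \<Rightarrow> bool" where
  "psd_on S B \<longleftrightarrow>
     (\<forall>i\<in>S. \<forall>j\<in>S. B i j = B j i) \<and>
     (\<forall>x :: 'a \<Rightarrow> real. 0 \<le> (\<Sum>i\<in>S. \<Sum>j\<in>S. x i * B i j * x j))"

definition PSD_completable :: "'a ugraph \<Rightarrow> 'a partial_matrix set" where
  "PSD_completable G = {A \<in> Sym G. \<exists>B. psd_on (verts G) B \<and>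
     (\<forall>i\<in>verts G. B i i = entry A i i) \<and>
     (\<forall>i j. {i, j} \<in> edges G \<longrightarrow> B i j = entry A i j)}"

definition clique_PSD :: "'a ugraph \<Rightarrow> 'a partial_matrix set" where
  "clique_PSD G = {A \<in> Sym G. \<forall>C. maximal_clique G C \<longrightarrow> psd_on C (entry A)}"

definition clique_PSD1 :: "'a ugraph \<Rightarrow> 'a partial_matrix set" where
  "clique_PSD1 G = {A \<in> clique_PSD G. ptrace G A = 1}"

definition conical_distance :: "'a ugraph \<Rightarrow> real" where
  "conical_distance G = (LEAST \<epsilon>. 0 \<le> \<epsilon> \<and>
     (\<forall>M\<in>clique_PSD1 G.
        add_partial G M (scale_partial G \<epsilon> (id_partial G)) \<in> PSD_completable G))"

end

(*
  The shifts that work for a graph form a closed half-line [eps, oo): it is nonempty because the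
  number of vertices works (diagonal dominance), and closed because completions with bounded
  diagonal are bounded. So it suffices that a shift works for the clique sum iff it works for both
  summands. A partial matrix on G extends by zeros to the clique sum, where every clique meets G in
  a clique. Conversely, a partial matrix of trace 1 on the clique sum restricts to one of trace at
  most 1 on each summand; the two shifted completions agree on the common clique, where everything
  is specified, and positive semidefinite matrices agreeing on the overlap can be glued.
*)

theory Submission
  imports Defs
begin

section \<open>Positive semidefinite matrices\<close>

definition bil :: "'a set \<Rightarrow> ('a \<Rightarrow> 'a \<Rightarrow> real) \<Rightarrow> ('a \<Rightarrow> real) \<Rightarrow> ('a \<Rightarrow> real) \<Rightarrow> real" where
  "bil S A x y = (\<Sum>i\<in>S. \<Sum>j\<in>S. x i * A i j * y j)"

definition unit_at :: "'a \<Rightarrow> 'a \<Rightarrow> real" where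
  "unit_at k i = (if i = k then 1 else 0)"

lemma psd_on_bil:
  "psd_on S A \<longleftrightarrow> (\<forall>i\<in>S. \<forall>j\<in>S. A i j = A j i) \<and> (\<forall>x. 0 \<le> bil S A x x)"
  by (simp add: psd_on_def bil_def)

lemma bil_cong:
  assumes "\<And>i j. i \<in> S \<Longrightarrow> j \<in> S \<Longrightarrow> x i * A i j * y j = x' i * A' i j * y' j"
  shows "bil S A x y = bil S A' x' y'"
  unfolding bil_def by (intro sum.cong refl assms)

lemma bil_add_left: "bil S A (\<lambda>i. x i + y i) z = bil S A x z + bil S A y z"
  by (simp add: bil_def algebra_simps sum.distrib)

lemma bil_diff_left: "bil S A (\<lambda>i. x i - y i) z = bil S A x z - bil S A y z"
  by (simp add: bil_def algebra_simps sum_subtractf)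

lemma bil_scale_left: "bil S A (\<lambda>i. c * x i) z = c * bil S A x z"
  by (simp add: bil_def algebra_simps sum_distrib_left)

lemma bil_add_right: "bil S A z (\<lambda>i. x i + y i) = bil S A z x + bil S A z y"
  by (simp add: bil_def algebra_simps sum.distrib)

lemma bil_diff_right: "bil S A z (\<lambda>i. x i - y i) = bil S A z x - bil S A z y"
  by (simp add: bil_def algebra_simps sum_subtractf)

lemma bil_scale_right: "bil S A z (\<lambda>i. c * x i) = c * bil S A z x"
  by (simp add: bil_def algebra_simps sum_distrib_left)

lemmas bil_linear = bil_add_left bil_diff_left bil_scale_left
  bil_add_right bil_diff_right bil_scale_right

lemma bil_sum_left:
  "bil S A (\<lambda>i. \<Sum>u\<in>U. g u i) z = (\<Sum>u\<in>U. bil S A (g u) z)"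
proof (induction U rule: infinite_finite_induct)
  case (insert u U)
  then show ?case by (simp add: bil_add_left)
qed (simp_all add: bil_def)

lemma bil_sum_right:
  "bil S A z (\<lambda>i. \<Sum>u\<in>U. g u i) = (\<Sum>u\<in>U. bil S A z (g u))"
proof (induction U rule: infinite_finite_induct)
  case (insert u U)
  then show ?case by (simp add: bil_add_right)
qed (simp_all add: bil_def)

lemma bil_unit:
  assumes "finite S" "u \<in> S" "v \<in> S"
  shows "bil S A (unit_at u) (unit_at v) = A u v"
proof -
  have "bil S A (unit_at u) (unit_at v) =
      (\<Sum>i\<in>S. if i = u then (\<Sum>j\<in>S. if j = v then A u v else 0) else 0)"
    unfolding bil_def by (intro sum.cong) (auto simp: unit_at_def intro!: sum.cong)
  then show ?thesis using assms by simp
qed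

lemma bil_sym:
  assumes "psd_on S A"
  shows "bil S A x y = bil S A y x"
proof -
  have "bil S A x y = (\<Sum>j\<in>S. \<Sum>i\<in>S. x i * A i j * y j)"
    unfolding bil_def by (rule sum.swap)
  also have "\<dots> = bil S A y x"
    unfolding bil_def using assms
    by (intro sum.cong refl) (simp add: psd_on_def mult.commute mult.left_commute)
  finally show ?thesis .
qed

lemma bil_supported:
  assumes "finite S" "T \<subseteq> S"
    and "\<And>i. i \<notin> T \<Longrightarrow> x i = 0" "\<And>i. i \<notin> T \<Longrightarrow> y i = 0"
  shows "bil S A x y = bil T A x y"
proof -
  have "bil S A x y = (\<Sum>i\<in>T. \<Sum>j\<in>S. x i * A i j * y j)"
    unfolding bil_def using assms by (intro sum.mono_neutral_right) auto
  also have "\<dots> = bil T A x y"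
    unfolding bil_def using assms by (intro sum.cong refl sum.mono_neutral_right) auto
  finally show ?thesis .
qed

lemma bil_reindex:
  assumes "inj_on f S"
  shows "bil (f ` S) A x y = bil S (\<lambda>i j. A (f i) (f j)) (x \<circ> f) (y \<circ> f)"
  unfolding bil_def using assms by (simp add: sum.reindex)

section \<open>Operations that preserve positive semidefiniteness\<close>

lemma psd_on_symD: "psd_on S A \<Longrightarrow> i \<in> S \<Longrightarrow> j \<in> S \<Longrightarrow> A i j = A j i"
  by (simp add: psd_on_def)

lemma psd_on_cong:
  assumes "\<And>i j. i \<in> S \<Longrightarrow> j \<in> S \<Longrightarrow> A i j = B i j"
  shows "psd_on S A \<longleftrightarrow> psd_on S B"
proof -
  have "bil S A x x = bil S B x x" for x
    using assms by (intro bil_cong) simp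
  then show ?thesis using assms by (simp add: psd_on_bil)
qed

lemma psd_on_reindex:
  assumes "inj_on f S"
  shows "psd_on (f ` S) A \<longleftrightarrow> psd_on S (\<lambda>i j. A (f i) (f j))"
proof -
  have "(\<forall>x. 0 \<le> bil (f ` S) A x x) \<longleftrightarrow> (\<forall>x. 0 \<le> bil S (\<lambda>i j. A (f i) (f j)) x x)" (is "?L \<longleftrightarrow> ?R")
  proof
    assume L: ?L
    show ?R
    proof
      fix x
      \<comment> \<open>Every test vector on \<open>S\<close> comes from one on the image, by
        transport along the inverse of \<open>f\<close>.\<close>
      have "bil S (\<lambda>i j. A (f i) (f j)) x x = bil (f ` S) A (x \<circ> inv_into S f) (x \<circ> inv_into S f)"
        unfolding bil_reindex[OF assms] using assms by (intro bil_cong) simp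
      then show "0 \<le> bil S (\<lambda>i j. A (f i) (f j)) x x" using L by simp
    qed
  qed (simp add: bil_reindex[OF assms])
  then show ?thesis by (simp add: psd_on_bil)
qed

text \<open>Padding with zeros has the same effect on the form as truncating the test vector to
  \<open>S \<inter> T\<close>.\<close>

lemma psd_on_zero_extend:
  assumes "finite S" "psd_on (S \<inter> T) A"
  shows "psd_on S (\<lambda>i j. if i \<in> T \<and> j \<in> T then A i j else 0)" (is "psd_on S ?B")
proof -
  have "0 \<le> bil S ?B x x" for x
  proof -
    let ?y = "\<lambda>i. if i \<in> S \<inter> T then x i else 0"
    have "bil S ?B x x = bil S A ?y ?y"
      by (intro bil_cong) auto
    also have "\<dots> = bil (S \<inter> T) A ?y ?y"
      using assms(1) by (intro bil_supported) auto
    finally show ?thesis using assms(2) by (simp add: psd_on_bil)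
  qed
  moreover have "\<forall>i\<in>S. \<forall>j\<in>S. ?B i j = ?B j i"
    using assms(2) by (auto simp: psd_on_def)
  ultimately show ?thesis by (simp add: psd_on_bil)
qed

lemma psd_on_subset:
  assumes "finite S" "T \<subseteq> S" "psd_on S A"
  shows "psd_on T A"
proof -
  have "0 \<le> bil T A x x" for x
  proof -
    let ?y = "\<lambda>i. if i \<in> T then x i else 0"
    have "bil T A x x = bil T A ?y ?y" by (intro bil_cong) simp
    also have "\<dots> = bil S A ?y ?y"
      using assms(1,2) by (intro bil_supported[symmetric]) auto
    finally show ?thesis using assms(3) by (simp add: psd_on_bil)
  qed
  then show ?thesis using assms(2,3) by (simp add: psd_on_bil subset_iff)
qed

lemma psd_on_add:
  assumes "psd_on S A" "psd_on S B"
  shows "psd_on S (\<lambda>i j. A i j + B i j)"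
proof -
  have "bil S (\<lambda>i j. A i j + B i j) x x = bil S A x x + bil S B x x" for x
    by (simp add: bil_def algebra_simps sum.distrib)
  then show ?thesis using assms by (simp add: psd_on_bil)
qed

lemma psd_on_scale:
  assumes "psd_on S A" "0 \<le> c"
  shows "psd_on S (\<lambda>i j. c * A i j)"
proof -
  have "bil S (\<lambda>i j. c * A i j) x x = c * bil S A x x" for x
    by (simp add: bil_def algebra_simps sum_distrib_left)
  then show ?thesis using assms by (simp add: psd_on_bil)
qed

lemma psd_on_diagonal:
  assumes "finite S" "\<And>i. i \<in> S \<Longrightarrow> 0 \<le> d i"
  shows "psd_on S (\<lambda>i j. if i = j then d i else 0)" (is "psd_on S ?D")
proof -
  have "bil S ?D x x = (\<Sum>i\<in>S. d i * (x i)\<^sup>2)" for x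
  proof -
    have "bil S ?D x x = (\<Sum>i\<in>S. \<Sum>j\<in>S. if i = j then d i * (x i)\<^sup>2 else 0)"
      unfolding bil_def by (intro sum.cong) (auto simp: power2_eq_square)
    then show ?thesis using assms(1) by simp
  qed
  then show ?thesis using assms by (auto simp: psd_on_bil intro!: sum_nonneg)
qed

text \<open>By bilinearity the form of a Gram matrix at \<open>x\<close> is the form of
  \<open>A\<close> at the linear combination of the vectors \<open>g u\<close> with coefficients
  \<open>x u\<close>.\<close>

lemma psd_on_gram:
  assumes "psd_on S A"
  shows "psd_on U (\<lambda>u v. bil S A (g u) (g v))"
proof -
  have "bil U (\<lambda>u v. bil S A (g u) (g v)) x x =
      bil S A (\<lambda>i. \<Sum>u\<in>U. x u * g u i) (\<lambda>i. \<Sum>u\<in>U. x u * g u i)" for x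
    unfolding bil_sum_left bil_sum_right bil_scale_left bil_scale_right
    by (simp add: bil_def[of U] mult.assoc mult.commute mult.left_commute)
  then show ?thesis using assms bil_sym[OF assms] by (auto simp: psd_on_bil)
qed

section \<open>Entry bounds, diagonal dominance and limits\<close>

lemma psd_on_diag_nonneg:
  assumes "finite S" "psd_on S A" "i \<in> S"
  shows "0 \<le> A i i"
  using assms bil_unit[of S i i A] by (metis psd_on_bil)

text \<open>Testing the form on the sum and the difference of two unit vectors bounds the entry from
  both sides.\<close>

lemma psd_on_entry_bound:
  assumes "finite S" "psd_on S A" "i \<in> S" "j \<in> S"
  shows "2 * \<bar>A i j\<bar> \<le> A i i + A j j"
proof -
  let ?u = "unit_at i" and ?v = "unit_at j"
  have "0 \<le> bil S A (\<lambda>k. ?u k + ?v k) (\<lambda>k. ?u k + ?v k)"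
    "0 \<le> bil S A (\<lambda>k. ?u k - ?v k) (\<lambda>k. ?u k - ?v k)"
    using assms(2) by (simp_all add: psd_on_bil)
  then show ?thesis
    using assms psd_on_symD[OF assms(2), of i j] by (simp add: bil_linear bil_unit)
qed

text \<open>Since 2|ab| \<le> a^2 + b^2, the form of \<open>A\<close> at \<open>x\<close> is at
  least minus \<open>card S\<close> times the squared length of \<open>x\<close>, which the added
  diagonal compensates.\<close>

lemma psd_on_bounded_entries:
  assumes "finite S" "\<And>i j. i \<in> S \<Longrightarrow> j \<in> S \<Longrightarrow> A i j = A j i"
    and "\<And>i j. i \<in> S \<Longrightarrow> j \<in> S \<Longrightarrow> \<bar>A i j\<bar> \<le> 1"
  shows "psd_on S (\<lambda>i j. A i j + (if i = j then real (card S) else 0))" (is "psd_on S ?B")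
proof -
  have "0 \<le> bil S ?B x x" for x
  proof -
    have "- (((x i)\<^sup>2 + (x j)\<^sup>2) / 2) \<le> x i * A i j * x j" if "i \<in> S" "j \<in> S" for i j
    proof -
      have "\<bar>x i * A i j * x j\<bar> = \<bar>A i j\<bar> * (\<bar>x i\<bar> * \<bar>x j\<bar>)" by (simp add: abs_mult)
      also have "\<dots> \<le> 1 * (\<bar>x i\<bar> * \<bar>x j\<bar>)"
        using assms(3)[OF that] by (intro mult_right_mono) auto
      also have "\<dots> \<le> ((x i)\<^sup>2 + (x j)\<^sup>2) / 2"
        using sum_squares_bound[of "\<bar>x i\<bar>" "\<bar>x j\<bar>"] by simp
      finally show ?thesis by linarith
    qed
    then have "(\<Sum>i\<in>S. \<Sum>j\<in>S. - (((x i)\<^sup>2 + (x j)\<^sup>2) / 2)) \<le> bil S A x x"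
      unfolding bil_def by (intro sum_mono) auto
    moreover have "(\<Sum>i\<in>S. \<Sum>j\<in>S. - (((x i)\<^sup>2 + (x j)\<^sup>2) / 2)) = - (card S * (\<Sum>i\<in>S. (x i)\<^sup>2))"
      by (simp add: sum.distrib sum_negf sum_divide_distrib[symmetric] sum_distrib_left[symmetric])
    moreover have "bil S ?B x x = bil S A x x + card S * (\<Sum>i\<in>S. (x i)\<^sup>2)"
    proof -
      have "bil S ?B x x = bil S A x x +
          (\<Sum>i\<in>S. \<Sum>j\<in>S. if i = j then card S * (x i)\<^sup>2 else 0)"
        unfolding bil_def sum.distrib[symmetric]
        by (intro sum.cong refl) (simp add: power2_eq_square algebra_simps)
      then show ?thesis using assms(1) by (simp add: sum_distrib_left)
    qed
    ultimately show ?thesis by linarith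
  qed
  then show ?thesis using assms(2) by (simp add: psd_on_bil)
qed

text \<open>For each fixed test vector the form depends continuously on the entries, so symmetry and
  nonnegativity survive the limit.\<close>

lemma psd_on_limit:
  assumes "\<And>n. psd_on S (A n)"
    and lim: "\<And>i j. i \<in> S \<Longrightarrow> j \<in> S \<Longrightarrow> (\<lambda>n. A n i j) \<longlonglongrightarrow> L i j"
  shows "psd_on S L"
proof -
  have "L i j = L j i" if "i \<in> S" "j \<in> S" for i j
  proof (rule LIMSEQ_unique)
    show "(\<lambda>n. A n i j) \<longlonglongrightarrow> L i j" using lim that .
    have "(\<lambda>n. A n i j) = (\<lambda>n. A n j i)" using psd_on_symD[OF assms(1)] that by blast
    then show "(\<lambda>n. A n i j) \<longlonglongrightarrow> L j i" using lim[OF that(2,1)] by simp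
  qed
  moreover have "0 \<le> bil S L x x" for x
  proof (rule LIMSEQ_le_const)
    show "(\<lambda>n. bil S (A n) x x) \<longlonglongrightarrow> bil S L x x"
      unfolding bil_def by (intro tendsto_intros lim)
    show "\<exists>N. \<forall>n\<ge>N. 0 \<le> bil S (A n) x x"
      using assms(1) by (simp add: psd_on_bil)
  qed
  ultimately show ?thesis by (simp add: psd_on_bil)
qed

section \<open>Orthogonal projection and gluing for possibly degenerate forms\<close>

lemma bil_isotropic:
  assumes "psd_on S A" "bil S A r r = 0"
  shows "bil S A z r = 0"
proof (rule ccontr)
  assume nz: "bil S A z r \<noteq> 0"
  \<comment> \<open>The form at \<open>z + s r\<close> is affine in \<open>s\<close> because
    \<open>r\<close> is isotropic; with nonzero slope it takes every real value, and this
    \<open>s\<close> yields -1.\<close>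
  define s where "s = - (bil S A z z + 1) / (2 * bil S A z r)"
  have "0 \<le> bil S A (\<lambda>i. z i + s * r i) (\<lambda>i. z i + s * r i)"
    using assms(1) by (simp add: psd_on_bil)
  also have "\<dots> = bil S A z z + 2 * s * bil S A z r"
    using assms(2) bil_sym[OF assms(1), of r z] by (simp add: bil_linear)
  also have "\<dots> = -1" using nz by (simp add: s_def field_simps)
  finally show False by simp
qed

text \<open>An orthogonal projection \<open>b\<close> of \<open>x\<close> onto the vectors supported
  on \<open>T\<close> is built by Gram-Schmidt, one coordinate at a time. For a degenerate form it
  need not be unique, but it exists.\<close>

lemma psd_on_projection:
  assumes "finite T" "psd_on S A"
  shows "\<exists>b. (\<forall>i. i \<notin> T \<longrightarrow> b i = 0) \<and>
    (\<forall>y. (\<forall>i. i \<notin> T \<longrightarrow> y i = 0) \<longrightarrow> bil S A (\<lambda>i. x i - b i) y = 0)"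
  using assms(1)
proof (induction T arbitrary: x)
  case empty
  show ?case by (intro exI[of _ "\<lambda>_. 0"]) (simp add: bil_def)
next
  case (insert m T)
  obtain b where b: "\<And>i. i \<notin> T \<Longrightarrow> b i = 0"
    "\<And>y. (\<forall>i. i \<notin> T \<longrightarrow> y i = 0) \<Longrightarrow> bil S A (\<lambda>i. x i - b i) y = 0"
    using insert.IH[of x] by blast
  obtain c where c: "\<And>i. i \<notin> T \<Longrightarrow> c i = 0"
    "\<And>y. (\<forall>i. i \<notin> T \<longrightarrow> y i = 0) \<Longrightarrow> bil S A (\<lambda>i. unit_at m i - c i) y = 0"
    using insert.IH[of "unit_at m"] by blast
  \<comment> \<open>The residuals \<open>z\<close> and \<open>r\<close> of \<open>x\<close> and of
    the new unit vector are orthogonal to all vectors supported on \<open>T\<close>; subtracting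
    \<open>s * r\<close> makes \<open>z\<close> orthogonal to \<open>r\<close> as well.\<close>
  define z where "z = (\<lambda>i. x i - b i)"
  define r where "r = (\<lambda>i. unit_at m i - c i)"
  define s where "s = bil S A z r / bil S A r r"
  define b' where "b' = (\<lambda>i. b i + s * r i)"
  have r: "r m = 1" "\<And>i. i \<notin> insert m T \<Longrightarrow> r i = 0"
    using c(1) insert.hyps by (auto simp: r_def unit_at_def)
  \<comment> \<open>also in the degenerate case \<open>bil S A r r = 0\<close>, where \<open>s = 0\<close>\<close>
  have s: "bil S A z r = s * bil S A r r"
    using bil_isotropic[OF assms(2), of r z] by (simp add: s_def)
  show ?case
  proof (intro exI[of _ b'] conjI allI impI)
    show "b' i = 0" if "i \<notin> insert m T" for i
      using that b(1) r(2) by (simp add: b'_def)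
    fix y :: "'a \<Rightarrow> real"
    assume y: "\<forall>i. i \<notin> insert m T \<longrightarrow> y i = 0"
    \<comment> \<open>As \<open>r m = 1\<close>, removing \<open>y m * r\<close> from
      \<open>y\<close> kills the coordinate \<open>m\<close> and leaves a vector supported on
      \<open>T\<close>.\<close>
    define w where "w = (\<lambda>i. y i - y m * r i)"
    have w0: "\<forall>i. i \<notin> T \<longrightarrow> w i = 0"
    proof (intro allI impI)
      fix i assume "i \<notin> T"
      then show "w i = 0" using y r by (cases "i = m") (simp_all add: w_def)
    qed
    have "bil S A (\<lambda>i. x i - b' i) y = bil S A (\<lambda>i. z i - s * r i) (\<lambda>i. w i + y m * r i)"
      by (intro bil_cong) (simp add: b'_def z_def w_def)
    also have "\<dots> = 0"
      using b(2)[OF w0] c(2)[OF w0] s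
      by (simp add: bil_linear z_def[symmetric] r_def[symmetric])
    finally show "bil S A (\<lambda>i. x i - b' i) y = 0" .
  qed
qed

text \<open>
  Every unit vector of \<open>T\<close> splits into its projection onto the span of \<open>S \<inter> T\<close> and a remainder
  orthogonal to that span. The glued form keeps the projections inside \<open>S\<close> and makes the
  remainders orthogonal to \<open>S\<close>, so it is a sum of two Gram matrices.
\<close>

lemma psd_on_glue:
  assumes "finite S" "finite T" "psd_on S A" "psd_on T B"
    and agree: "\<And>i j. i \<in> S \<inter> T \<Longrightarrow> j \<in> S \<inter> T \<Longrightarrow> A i j = B i j"
  obtains C where "psd_on (S \<union> T) C"
    "\<And>i j. i \<in> S \<Longrightarrow> j \<in> S \<Longrightarrow> C i j = A i j"
    "\<And>i j. i \<in> T \<Longrightarrow> j \<in> T \<Longrightarrow> C i j = B i j"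
proof -
  have "\<forall>v. \<exists>b. (\<forall>i. i \<notin> S \<inter> T \<longrightarrow> b i = 0) \<and>
    (\<forall>y. (\<forall>i. i \<notin> S \<inter> T \<longrightarrow> y i = 0) \<longrightarrow> bil T B (\<lambda>i. unit_at v i - b i) y = 0)"
    using assms by (intro allI psd_on_projection) auto
  then obtain b where b: "\<And>v i. i \<notin> S \<inter> T \<Longrightarrow> b v i = 0"
    "\<And>v y. (\<forall>i. i \<notin> S \<inter> T \<longrightarrow> y i = 0) \<Longrightarrow> bil T B (\<lambda>i. unit_at v i - b v i) y = 0"
    by metis
  define p where "p v = (if v \<in> S then unit_at v else b v)" for v
  define r where "r v = (\<lambda>i. unit_at v i - p v i)" for v
  define C where "C u v = bil S A (p u) (p v) + bil T B (r u) (r v)" for u v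
  \<comment> \<open>For vertices of \<open>T\<close> the kept parts are supported on the overlap, as
    unit vectors or as projections, so \<open>A\<close> and \<open>B\<close> take the same values on
    them.\<close>
  have p0: "p v i = 0" if "v \<in> T" "i \<notin> S \<inter> T" for v i
    using that b(1) by (auto simp: p_def unit_at_def)
  \<comment> \<open>Remainders are orthogonal to the kept parts, so the cross terms disappear when
    \<open>B\<close> is expanded at two unit vectors.\<close>
  have rp: "bil T B (r u) (p v) = 0" if "v \<in> T" for u v
  proof (cases "u \<in> S")
    case True
    then show ?thesis by (simp add: r_def p_def bil_def)
  next
    case False
    then show ?thesis using b(2)[of "p v" u] p0 that by (simp add: r_def p_def)
  qed
  show thesis
  proof
    show "psd_on (S \<union> T) C"
      unfolding C_def using assms by (intro psd_on_add psd_on_gram)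
    show "C i j = A i j" if "i \<in> S" "j \<in> S" for i j
    proof -
      have "bil T B (r i) (r j) = 0" using that by (simp add: r_def p_def bil_def)
      then show ?thesis using that assms(1) by (simp add: C_def p_def bil_unit)
    qed
    show "C i j = B i j" if ij: "i \<in> T" "j \<in> T" for i j
    proof -
      have "bil S A (p i) (p j) = bil (S \<inter> T) A (p i) (p j)"
        using assms(1) p0 ij by (intro bil_supported) auto
      also have "\<dots> = bil (S \<inter> T) B (p i) (p j)"
        using agree by (intro bil_cong) auto
      also have "\<dots> = bil T B (p i) (p j)"
        using assms(2) p0 ij by (intro bil_supported[symmetric]) auto
      finally have "C i j = bil T B (p i) (p j) + bil T B (r i) (r j)"
        by (simp add: C_def)
      also have "\<dots> = bil T B (\<lambda>k. p i k + r i k) (\<lambda>k. p j k + r j k)"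
        using rp[OF ij(1)] rp[OF ij(2)] bil_sym[OF assms(4)]
        by (simp add: bil_linear)
      also have "\<dots> = bil T B (unit_at i) (unit_at j)"
        by (simp add: r_def)
      finally show ?thesis using ij assms(2) by (simp add: bil_unit)
    qed
  qed
qed

section \<open>Admissible shifts\<close>

text \<open>All cliques are tested, because images and preimages of maximal cliques need not be
  maximal. Matrices are plain functions on pairs of vertices; only diagonal and edge entries are
  read.\<close>

definition locally_psd :: "'a ugraph \<Rightarrow> ('a \<Rightarrow> 'a \<Rightarrow> real) \<Rightarrow> bool" where
  "locally_psd G B \<longleftrightarrow> (\<forall>C. graph_clique G C \<longrightarrow> psd_on C B)"

text \<open>The shift sits in the diagonal condition, so the data \<open>B\<close> stay fixed while
  \<open>\<epsilon>\<close> varies.\<close>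

definition psd_completion ::
  "'a ugraph \<Rightarrow> ('a \<Rightarrow> 'a \<Rightarrow> real) \<Rightarrow> real \<Rightarrow> ('a \<Rightarrow> 'a \<Rightarrow> real) \<Rightarrow> bool" where
  "psd_completion G B \<epsilon> D \<longleftrightarrow> psd_on (verts G) D \<and>
     (\<forall>i\<in>verts G. D i i = B i i + \<epsilon>) \<and> (\<forall>i j. {i, j} \<in> edges G \<longrightarrow> D i j = B i j)"

text \<open>The condition minimised in \<open>conical_distance\<close>, rephrased for functions on
  pairs of vertices; \<open>admissible_iff\<close> justifies the change of encoding.\<close>

definition admissible :: "'a ugraph \<Rightarrow> real \<Rightarrow> bool" where
  "admissible G \<epsilon> \<longleftrightarrow> 0 \<le> \<epsilon> \<and>
     (\<forall>B. locally_psd G B \<and> (\<Sum>i\<in>verts G. B i i) = 1 \<longrightarrow> (\<exists>D. psd_completion G B \<epsilon> D))"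

section \<open>Edges and cliques of simple graphs\<close>

lemma simple_graph_edgeD:
  assumes "simple_graph G" "{i, j} \<in> edges G"
  shows "i \<in> verts G" "j \<in> verts G" "i \<noteq> j"
  using assms by (auto simp: simple_graph_def nsets_def card_insert_if split: if_splits)

lemma simple_graph_edgeE:
  assumes "simple_graph G" "e \<in> edges G"
  obtains i j where "e = {i, j}" "i \<noteq> j" "i \<in> verts G" "j \<in> verts G"
  using assms by (auto simp: simple_graph_def nsets_def card_2_iff)

lemma simple_graph_edge_image:
  assumes "simple_graph G" "inj p" "f \<in> edges G"
  shows "p ` f \<in> [p ` verts G]\<^bsup>2\<^esup>"
proof -
  have "f \<subseteq> verts G \<and> finite f \<and> card f = 2"
    using assms(1,3) by (auto simp: simple_graph_def nsets_def)
  then show ?thesis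
    by (simp add: nsets_def image_mono card_image[OF inj_on_subset[OF assms(2)]])
qed

lemma graph_clique_finite: "simple_graph G \<Longrightarrow> graph_clique G C \<Longrightarrow> finite C"
  by (auto simp: simple_graph_def graph_clique_def intro: finite_subset)

lemma graph_clique_single: "i \<in> verts G \<Longrightarrow> graph_clique G {i}"
  by (simp add: graph_clique_def clique_def)

lemma graph_clique_edge: "simple_graph G \<Longrightarrow> {i, j} \<in> edges G \<Longrightarrow> graph_clique G {i, j}"
  by (auto simp: graph_clique_def clique_def insert_commute dest: simple_graph_edgeD)

lemma graph_clique_subset_maximal:
  assumes "simple_graph G" "graph_clique G C"
  obtains D where "maximal_clique G D" "C \<subseteq> D"
proof -
  have "finite {D. graph_clique G D}"
    by (rule finite_subset[of _ "Pow (verts G)"])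
      (use assms in \<open>auto simp: simple_graph_def graph_clique_def\<close>)
  then obtain D where "D \<in> {D. graph_clique G D}" "C \<subseteq> D"
    "\<forall>E\<in>{D. graph_clique G D}. D \<subseteq> E \<longrightarrow> D = E"
    using finite_has_maximal2[of "{D. graph_clique G D}" C] assms(2) by auto
  then show thesis using that[of D] by (auto simp: maximal_clique_def)
qed

text \<open>Every clique lies in a maximal one, and principal submatrices inherit positive
  semidefiniteness.\<close>

lemma locally_psd_maximal:
  assumes "simple_graph G"
  shows "locally_psd G B \<longleftrightarrow> (\<forall>C. maximal_clique G C \<longrightarrow> psd_on C B)"
proof
  assume max: "\<forall>C. maximal_clique G C \<longrightarrow> psd_on C B"
  show "locally_psd G B"
    unfolding locally_psd_def
  proof (intro allI impI)
    fix C assume "graph_clique G C"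
    then obtain D where D: "maximal_clique G D" "C \<subseteq> D"
      using graph_clique_subset_maximal[OF assms] by blast
    moreover have "finite D"
      using D(1) assms by (simp add: maximal_clique_def graph_clique_finite)
    ultimately show "psd_on C B" using max psd_on_subset by blast
  qed
qed (simp add: locally_psd_def maximal_clique_def)

lemma locally_psd_diag_nonneg:
  "locally_psd G B \<Longrightarrow> i \<in> verts G \<Longrightarrow> 0 \<le> B i i"
  using graph_clique_single[of i G] psd_on_diag_nonneg[of "{i}" B i]
  by (auto simp: locally_psd_def)

text \<open>The two ends of an edge form a clique, so the facts on two-by-two positive semidefinite
  matrices apply.\<close>

lemma locally_psd_edge:
  assumes "simple_graph G" "locally_psd G B" "{i, j} \<in> edges G"
  shows "B i j = B j i" "2 * \<bar>B i j\<bar> \<le> B i i + B j j"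
proof -
  have "psd_on {i, j} B"
    using assms graph_clique_edge[OF assms(1,3)] by (simp add: locally_psd_def)
  then show "B i j = B j i" "2 * \<bar>B i j\<bar> \<le> B i i + B j j"
    using psd_on_symD[of "{i, j}"] psd_on_entry_bound[of "{i, j}"] by auto
qed

lemma locally_psd_diag_le_trace:
  assumes "simple_graph G" "locally_psd G B" "i \<in> verts G"
  shows "B i i \<le> (\<Sum>i\<in>verts G. B i i)"
  using assms locally_psd_diag_nonneg[OF assms(2)]
  by (intro member_le_sum) (auto simp: simple_graph_def)

text \<open>Both conditions read only diagonal and edge entries; once symmetric on edges, a function
  on pairs carries the same data there as an extensional family.\<close>

lemma admissible_iff:
  assumes G: "simple_graph G"
  shows "admissible G \<epsilon> \<longleftrightarrow> 0 \<le> \<epsilon> \<and>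
    (\<forall>M\<in>clique_PSD1 G.
       add_partial G M (scale_partial G \<epsilon> (id_partial G)) \<in> PSD_completable G)"
proof -
  have shift: "add_partial G M (scale_partial G \<epsilon> (id_partial G)) \<in> PSD_completable G \<longleftrightarrow>
      (\<exists>D. psd_completion G (entry M) \<epsilon> D)" for M
  proof -
    let ?N = "add_partial G M (scale_partial G \<epsilon> (id_partial G))"
    have "?N \<in> Sym G" by (simp add: Sym_def add_partial_def)
    moreover have "entry ?N i i = entry M i i + \<epsilon>" if "i \<in> verts G" for i
      using that by (simp add: entry_def add_partial_def scale_partial_def id_partial_def Plus_def)
    moreover have "entry ?N i j = entry M i j" if "{i, j} \<in> edges G" for i j
      using that simple_graph_edgeD[OF G that]
      by (simp add: entry_def add_partial_def scale_partial_def id_partial_def InrI)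
    ultimately show ?thesis
      by (simp add: PSD_completable_def psd_completion_def)
  qed
  have tr: "ptrace G M = (\<Sum>i\<in>verts G. entry M i i)" for M
    by (simp add: ptrace_def entry_def)
  show ?thesis
  proof (intro iffI conjI ballI)
    fix M
    assume adm: "admissible G \<epsilon>" and M: "M \<in> clique_PSD1 G"
    have "locally_psd G (entry M)"
      using M by (simp add: clique_PSD1_def clique_PSD_def locally_psd_maximal[OF G])
    then show "add_partial G M (scale_partial G \<epsilon> (id_partial G)) \<in> PSD_completable G"
      using adm M by (simp add: shift admissible_def clique_PSD1_def tr)
  next
    assume R: "0 \<le> \<epsilon> \<and> (\<forall>M\<in>clique_PSD1 G.
      add_partial G M (scale_partial G \<epsilon> (id_partial G)) \<in> PSD_completable G)"
    have "\<exists>D. psd_completion G B \<epsilon> D"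
      if B: "locally_psd G B" and B1: "(\<Sum>i\<in>verts G. B i i) = 1" for B
    proof -
      \<comment> \<open>An edge is an unordered pair, so its entry is chosen from either order of
        the ends; symmetry of \<open>B\<close> on edges makes the choice immaterial.\<close>
      define M where "M = restrict (case_sum (\<lambda>i. B i i)
        (\<lambda>e. SOME x. \<exists>i j. e = {i, j} \<and> x = B i j)) (verts G <+> edges G)"
      have diag: "entry M i i = B i i" if "i \<in> verts G" for i
        using that by (simp add: entry_def M_def InlI)
      have edge: "entry M i j = B i j" if e: "{i, j} \<in> edges G" for i j
      proof -
        have "(SOME x. \<exists>k l. {i, j} = {k, l} \<and> x = B k l) = B i j"
          using locally_psd_edge(1)[OF G B e]
          by (intro some_equality) (auto simp: doubleton_eq_iff)
        then show ?thesis
          using e simple_graph_edgeD[OF G e] by (simp add: entry_def M_def InrI)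
      qed
      have "psd_on C (entry M)" if "maximal_clique G C" for C
      proof -
        have C: "graph_clique G C" using that by (simp add: maximal_clique_def)
        have "psd_on C (entry M) \<longleftrightarrow> psd_on C B"
        proof (rule psd_on_cong)
          fix i j assume "i \<in> C" "j \<in> C"
          then show "entry M i j = B i j"
            using C diag edge by (cases "i = j") (auto simp: graph_clique_def clique_def)
        qed
        then show ?thesis using B C by (simp add: locally_psd_def)
      qed
      then have "M \<in> clique_PSD1 G"
        using B1 diag by (simp add: clique_PSD1_def clique_PSD_def Sym_def tr M_def)
      then obtain D where "psd_completion G (entry M) \<epsilon> D"
        using R shift by blast
      then have "psd_completion G B \<epsilon> D"
        using diag edge by (simp add: psd_completion_def)
      then show ?thesis by blast
    qed
    then show "admissible G \<epsilon>" using R by (simp add: admissible_def)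
  qed (simp add: admissible_def)
qed

section \<open>The admissible shifts as a closed half-line\<close>

lemma psd_completion_raise:
  assumes "simple_graph G" "psd_completion G B \<delta> D" "\<delta> \<le> \<epsilon>"
  shows "psd_completion G B \<epsilon> (\<lambda>i j. D i j + (if i = j then \<epsilon> - \<delta> else 0))"
  using assms simple_graph_edgeD(3)[OF assms(1)]
  by (auto simp: psd_completion_def simple_graph_def intro!: psd_on_add psd_on_diagonal)

text \<open>Scaling to trace 1 shows that a matrix of trace \<open>t\<close> needs only the shift
  \<open>t * \<epsilon>\<close>, which is at most \<open>\<epsilon>\<close>. This serves for
  restrictions of trace-one matrices to a summand, whose trace may be smaller.\<close>

lemma admissible_completion:
  assumes G: "simple_graph G" and adm: "admissible G \<epsilon>"
    and B: "locally_psd G B" and tr: "(\<Sum>i\<in>verts G. B i i) \<le> 1"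
  shows "\<exists>D. psd_completion G B \<epsilon> D"
proof -
  define t where "t = (\<Sum>i\<in>verts G. B i i)"
  have t0: "0 \<le> t"
    unfolding t_def using locally_psd_diag_nonneg[OF B] by (intro sum_nonneg)
  have "\<exists>D. psd_completion G B (t * \<epsilon>) D"
  proof (cases "t = 0")
    case True
    \<comment> \<open>Trace zero cannot be normalised. The nonnegative diagonal entries then vanish,
      the edge bound kills the edge entries, and the zero matrix is a completion.\<close>
    have "B i i = 0" if "i \<in> verts G" for i
      using locally_psd_diag_le_trace[OF G B that] locally_psd_diag_nonneg[OF B that] True
      by (simp add: t_def)
    moreover have "B i j = 0" if "{i, j} \<in> edges G" for i j
      using locally_psd_edge(2)[OF G B that] simple_graph_edgeD[OF G that] calculation by simp
    ultimately have "psd_completion G B (t * \<epsilon>) (\<lambda>i j. 0)"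
      using True by (simp add: psd_completion_def psd_on_def)
    then show ?thesis by blast
  next
    case False
    then have t: "0 < t" using t0 by simp
    let ?B = "\<lambda>i j. inverse t * B i j"
    have "locally_psd G ?B"
      using B t by (auto simp: locally_psd_def intro!: psd_on_scale)
    moreover have "(\<Sum>i\<in>verts G. ?B i i) = 1"
      using t by (simp add: sum_distrib_left[symmetric] t_def)
    ultimately obtain D where D: "psd_completion G ?B \<epsilon> D"
      using adm by (auto simp: admissible_def)
    then have "psd_completion G B (t * \<epsilon>) (\<lambda>i j. t * D i j)"
      using t by (auto simp: psd_completion_def algebra_simps intro!: psd_on_scale)
    then show ?thesis by blast
  qed
  moreover have "t * \<epsilon> \<le> \<epsilon>"
    using adm tr mult_right_mono[of t 1 \<epsilon>] by (simp add: t_def admissible_def)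
  ultimately show ?thesis using psd_completion_raise[OF G] by blast
qed

lemma admissible_mono:
  assumes "simple_graph G" "admissible G \<delta>" "\<delta> \<le> \<epsilon>"
  shows "admissible G \<epsilon>"
  using assms psd_completion_raise[OF assms(1)] unfolding admissible_def
  by (meson order_trans)

text \<open>Unspecified entries are filled with 0. Trace 1 bounds the diagonal by 1, the edge bound
  carries this over to edge entries, and \<open>psd_on_bounded_entries\<close> applies.\<close>

lemma admissible_card:
  assumes G: "simple_graph G"
  shows "admissible G (card (verts G))"
proof -
  have "\<exists>D. psd_completion G B (card (verts G)) D"
    if B: "locally_psd G B" and B1: "(\<Sum>i\<in>verts G. B i i) = 1" for B
  proof -
    have V: "finite (verts G)" using G by (simp add: simple_graph_def)
    define A where "A i j = (if i = j \<or> {i, j} \<in> edges G then B i j else 0)" for i j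
    have le1: "\<bar>B i i\<bar> \<le> 1" if "i \<in> verts G" for i
      using locally_psd_diag_le_trace[OF G B that] locally_psd_diag_nonneg[OF B that] B1 by simp
    have "\<bar>A i j\<bar> \<le> 1" if "i \<in> verts G" "j \<in> verts G" for i j
      using le1[OF that(1)] le1[OF that(2)] locally_psd_edge(2)[OF G B, of i j]
      by (auto simp: A_def)
    moreover have "A i j = A j i" for i j
      using locally_psd_edge(1)[OF G B, of i j] by (auto simp: A_def insert_commute)
    ultimately have "psd_on (verts G) (\<lambda>i j. A i j + (if i = j then real (card (verts G)) else 0))"
      using V by (intro psd_on_bounded_entries)
    then have "psd_completion G B (card (verts G))
        (\<lambda>i j. A i j + (if i = j then real (card (verts G)) else 0))"
      using simple_graph_edgeD(3)[OF G] by (auto simp: psd_completion_def A_def)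
    then show ?thesis by blast
  qed
  then show ?thesis by (simp add: admissible_def)
qed

text \<open>Bolzano-Weierstrass in finitely many coordinates, by refining the subsequence once per
  coordinate.\<close>

lemma pointwise_convergent_subseq:
  fixes f :: "nat \<Rightarrow> 'i \<Rightarrow> real"
  assumes "finite S" and "\<And>n i. i \<in> S \<Longrightarrow> \<bar>f n i\<bar> \<le> c"
  shows "\<exists>r l. strict_mono (r :: nat \<Rightarrow> nat) \<and> (\<forall>i\<in>S. (\<lambda>n. f (r n) i) \<longlonglongrightarrow> l i)"
  using assms
proof (induction S)
  case empty
  show ?case by (intro exI[of _ id]) (simp add: strict_mono_def)
next
  case (insert k S)
  then obtain r l where r: "strict_mono (r :: nat \<Rightarrow> nat)"
    and l: "\<And>i. i \<in> S \<Longrightarrow> (\<lambda>n. f (r n) i) \<longlonglongrightarrow> l i"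
    by (metis insertCI)
  have "bounded (range (\<lambda>n. f (r n) k))"
    using insert.prems[of k] by (intro boundedI[of _ c]) auto
  then obtain a s where s: "strict_mono (s :: nat \<Rightarrow> nat)"
    and a: "((\<lambda>n. f (r n) k) \<circ> s) \<longlonglongrightarrow> a"
    using bounded_imp_convergent_subsequence by blast
  show ?case
  proof (intro exI[of _ "r \<circ> s"] exI[of _ "l(k := a)"] conjI ballI)
    show "strict_mono (r \<circ> s)" using r s by (rule strict_mono_o)
    fix i assume "i \<in> insert k S"
    then show "(\<lambda>n. f ((r \<circ> s) n) i) \<longlonglongrightarrow> (l(k := a)) i"
      using a insert.hyps LIMSEQ_subseq_LIMSEQ[OF l s] by (auto simp: o_def)
  qed
qed

text \<open>Completions for shifts tending to \<open>\<epsilon>\<close> from above have uniformly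
  bounded entries; the limit of an entrywise convergent subsequence is a completion for
  \<open>\<epsilon>\<close> itself.\<close>

lemma admissible_limit:
  assumes G: "simple_graph G" and "0 \<le> \<epsilon>" and adm: "\<And>\<delta>. \<epsilon> < \<delta> \<Longrightarrow> admissible G \<delta>"
  shows "admissible G \<epsilon>"
proof -
  have "\<exists>L. psd_completion G B \<epsilon> L"
    if B: "locally_psd G B" and B1: "(\<Sum>i\<in>verts G. B i i) = 1" for B
  proof -
    have V: "finite (verts G)" using G by (simp add: simple_graph_def)
    define d where "d n = \<epsilon> + inverse (real (Suc n))" for n
    have "\<forall>n. \<exists>D. psd_completion G B (d n) D"
      using adm[of "d _"] B B1 by (auto simp: d_def admissible_def)
    then obtain D where D: "\<And>n. psd_completion G B (d n) (D n)" by metis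
    have d: "d n \<le> \<epsilon> + 1" for n
      by (simp add: d_def inverse_le_1_iff)
    \<comment> \<open>Trace 1 gives \<open>B i i \<le> 1\<close> and the shifts are at most
      \<open>\<epsilon> + 1\<close>, so the diagonal entries are at most
      \<open>2 + \<epsilon>\<close>; the other entries are bounded by averages of these.\<close>
    have bound: "\<bar>D n i j\<bar> \<le> 2 + \<epsilon>" if "i \<in> verts G" "j \<in> verts G" for n i j
    proof -
      have "B i i \<le> 1" "B j j \<le> 1"
        using that locally_psd_diag_le_trace[OF G B] B1 by auto
      moreover have "2 * \<bar>D n i j\<bar> \<le> D n i i + D n j j"
        using D[of n] V that by (intro psd_on_entry_bound) (auto simp: psd_completion_def)
      ultimately show ?thesis
        using D[of n] d[of n] that by (auto simp: psd_completion_def)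
    qed
    obtain r l where r: "strict_mono (r :: nat \<Rightarrow> nat)"
      and l: "\<And>i j. i \<in> verts G \<Longrightarrow> j \<in> verts G \<Longrightarrow> (\<lambda>n. D (r n) i j) \<longlonglongrightarrow> l (i, j)"
      using pointwise_convergent_subseq[of "verts G \<times> verts G" "\<lambda>n (i, j). D n i j" "2 + \<epsilon>"]
        V bound by fastforce
    have "d \<longlonglongrightarrow> \<epsilon> + 0"
      unfolding d_def by (intro tendsto_add tendsto_const LIMSEQ_inverse_real_of_nat)
    then have dr: "(\<lambda>n. d (r n)) \<longlonglongrightarrow> \<epsilon>"
      using LIMSEQ_subseq_LIMSEQ[OF _ r] by (auto simp: o_def)
    have "psd_completion G B \<epsilon> (\<lambda>i j. l (i, j))"
      unfolding psd_completion_def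
    proof (intro conjI ballI allI impI)
      show "psd_on (verts G) (\<lambda>i j. l (i, j))"
        by (rule psd_on_limit[where A = "\<lambda>n. D (r n)"])
          (use D l in \<open>auto simp: psd_completion_def\<close>)
    next
      fix i assume i: "i \<in> verts G"
      have "(\<lambda>n. D (r n) i i) = (\<lambda>n. B i i + d (r n))"
        using D i by (auto simp: psd_completion_def)
      moreover have "(\<lambda>n. B i i + d (r n)) \<longlonglongrightarrow> B i i + \<epsilon>"
        by (intro tendsto_intros dr)
      ultimately show "l (i, i) = B i i + \<epsilon>"
        using l[OF i i] LIMSEQ_unique by metis
    next
      fix i j assume e: "{i, j} \<in> edges G"
      have "(\<lambda>n. D (r n) i j) = (\<lambda>n. B i j)"
        using D e by (auto simp: psd_completion_def)
      then show "l (i, j) = B i j"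
        using l[of i j] simple_graph_edgeD[OF G e] LIMSEQ_unique tendsto_const by metis
    qed
    then show ?thesis by blast
  qed
  then show ?thesis using assms(2) by (simp add: admissible_def)
qed

text \<open>The admissible shifts are upward closed and contain their infimum, which is therefore
  the least element named by \<open>conical_distance\<close>.\<close>

lemma admissible_iff_conical_distance_le:
  assumes G: "simple_graph G"
  shows "admissible G \<epsilon> \<longleftrightarrow> conical_distance G \<le> \<epsilon>"
proof -
  define m where "m = Inf {\<delta>. admissible G \<delta>}"
  have ne: "{\<delta>. admissible G \<delta>} \<noteq> {}" using admissible_card[OF G] by blast
  have bdd: "bdd_below {\<delta>. admissible G \<delta>}"
    by (intro bdd_belowI[of _ 0]) (simp add: admissible_def)
  have m_le: "m \<le> \<delta>" if "admissible G \<delta>" for \<delta>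
    unfolding m_def using that bdd by (intro cInf_lower) auto
  \<comment> \<open>A number above the infimum exceeds some admissible shift and is admissible by
    monotonicity; \<open>admissible_limit\<close> then reaches the infimum itself.\<close>
  have "admissible G \<delta>" if "m < \<delta>" for \<delta>
    using that cInf_less_iff[OF ne bdd] admissible_mono[OF G]
    by (auto simp: m_def intro: less_imp_le)
  moreover have "0 \<le> m"
    unfolding m_def using ne by (intro cInf_greatest) (auto simp: admissible_def)
  ultimately have m: "admissible G m" using admissible_limit[OF G] by blast
  have "conical_distance G = (LEAST \<delta>. admissible G \<delta>)"
    unfolding conical_distance_def admissible_iff[OF G] ..
  also have "\<dots> = m"
    using m m_le by (rule Least_equality)
  finally show ?thesis using m m_le admissible_mono[OF G m] by auto
qed

section \<open>Induced subgraphs and amalgams\<close>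

text \<open>Injectivity is asked on the whole type, so that \<open>inv p\<close> undoes
  \<open>p\<close> everywhere; the maps into a clique sum satisfy it.\<close>

definition induced_embedding :: "('a \<Rightarrow> 'b) \<Rightarrow> 'a ugraph \<Rightarrow> 'b ugraph \<Rightarrow> bool" where
  "induced_embedding p G U \<longleftrightarrow> inj p \<and> p ` verts G \<subseteq> verts U \<and>
     (\<forall>i\<in>verts G. \<forall>j\<in>verts G. {p i, p j} \<in> edges U \<longleftrightarrow> {i, j} \<in> edges G)"

text \<open>The image of a clique is a clique, and reindexing along an injection preserves positive
  semidefiniteness.\<close>

lemma locally_psd_pullback:
  assumes p: "induced_embedding p G U" and B: "locally_psd U B"
  shows "locally_psd G (\<lambda>i j. B (p i) (p j))"
  unfolding locally_psd_def
proof (intro allI impI)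
  fix C assume "graph_clique G C"
  then have "graph_clique U (p ` C)"
    using p by (auto simp: graph_clique_def clique_def induced_embedding_def subset_iff)
  then have "psd_on (p ` C) B" using B by (simp add: locally_psd_def)
  moreover have "inj_on p C"
    using p by (auto simp: induced_embedding_def intro: inj_on_subset)
  ultimately show "psd_on C (\<lambda>i j. B (p i) (p j))" by (simp add: psd_on_reindex)
qed

lemma psd_completion_pullback:
  assumes G: "simple_graph G" and U: "simple_graph U" and p: "induced_embedding p G U"
    and D: "psd_completion U B \<epsilon> D"
  shows "psd_completion G (\<lambda>i j. B (p i) (p j)) \<epsilon> (\<lambda>i j. D (p i) (p j))"
proof -
  have "psd_on (p ` verts G) D"
    using U D p by (auto simp: simple_graph_def psd_completion_def induced_embedding_def
        intro: psd_on_subset)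
  moreover have "inj_on p (verts G)"
    using p by (auto simp: induced_embedding_def intro: inj_on_subset)
  ultimately have "psd_on (verts G) (\<lambda>i j. D (p i) (p j))" by (simp add: psd_on_reindex)
  moreover have "D (p i) (p j) = B (p i) (p j)" if "{i, j} \<in> edges G" for i j
    using simple_graph_edgeD[OF G that] that p D
    by (simp add: induced_embedding_def psd_completion_def)
  moreover have "D (p i) (p i) = B (p i) (p i) + \<epsilon>" if "i \<in> verts G" for i
    using that p D by (auto simp: induced_embedding_def psd_completion_def)
  ultimately show ?thesis by (simp add: psd_completion_def)
qed

text \<open>A matrix on \<open>G\<close> is padded with zeros to one on \<open>U\<close> with the
  same trace, completed there and restricted back.\<close>

lemma admissible_induced:
  assumes G: "simple_graph G" and U: "simple_graph U" and p: "induced_embedding p G U"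
    and adm: "admissible U \<epsilon>"
  shows "admissible G \<epsilon>"
proof -
  have inj: "inj p" and sub: "p ` verts G \<subseteq> verts U" and V: "finite (verts U)"
    using p U by (auto simp: induced_embedding_def simple_graph_def)
  have "\<exists>D. psd_completion G B \<epsilon> D"
    if B: "locally_psd G B" and B1: "(\<Sum>i\<in>verts G. B i i) = 1" for B
  proof -
    define A where "A u v = B (inv p u) (inv p v)" for u v
    define A0 where "A0 u v =
      (if u \<in> p ` verts G \<and> v \<in> p ` verts G then A u v else 0)" for u v
    have A0p: "A0 (p i) (p j) = B i j" if "i \<in> verts G" "j \<in> verts G" for i j
      using that inj by (simp add: A0_def A_def)
    have "psd_on C A0" if C: "graph_clique U C" for C
    proof -
      \<comment> \<open>The part of the clique inside the image of \<open>G\<close> pulls back to a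
        clique, since an induced embedding reflects edges; the padded matrix is zero off that
        part.\<close>
      define C' where "C' = {i \<in> verts G. p i \<in> C}"
      have "{v, w} \<in> edges G" if "v \<in> C'" "w \<in> C'" "v \<noteq> w" for v w
      proof -
        have "{p v, p w} \<in> edges U"
          using C that inj by (simp add: C'_def graph_clique_def clique_def inj_eq)
        then show ?thesis using that p by (simp add: C'_def induced_embedding_def)
      qed
      then have "graph_clique G C'" by (auto simp: C'_def graph_clique_def clique_def)
      then have "psd_on C' B" using B by (simp add: locally_psd_def)
      then have "psd_on (p ` C') A"
        using inj by (simp add: psd_on_reindex[OF inj_on_subset[OF inj]] A_def)
      moreover have "p ` C' = C \<inter> p ` verts G" by (auto simp: C'_def)
      ultimately show ?thesis
        unfolding A0_def using graph_clique_finite[OF U C] by (intro psd_on_zero_extend) auto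
    qed
    moreover have "(\<Sum>u\<in>verts U. A0 u u) = 1"
    proof -
      have "(\<Sum>u\<in>verts U. A0 u u) = (\<Sum>u\<in>p ` verts G. A0 u u)"
        using V sub by (intro sum.mono_neutral_right) (auto simp: A0_def)
      also have "\<dots> = (\<Sum>i\<in>verts G. B i i)"
        using A0p by (simp add: sum.reindex[OF inj_on_subset[OF inj]])
      finally show ?thesis using B1 by simp
    qed
    ultimately obtain D where "psd_completion U A0 \<epsilon> D"
      using adm by (auto simp: admissible_def locally_psd_def)
    then have "psd_completion G (\<lambda>i j. A0 (p i) (p j)) \<epsilon> (\<lambda>i j. D (p i) (p j))"
      by (rule psd_completion_pullback[OF G U p])
    then have "psd_completion G B \<epsilon> (\<lambda>i j. D (p i) (p j))"
      using A0p simple_graph_edgeD[OF G] by (simp add: psd_completion_def)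
    then show ?thesis by blast
  qed
  then show ?thesis using adm by (simp add: admissible_def)
qed

text \<open>The dropped diagonal entries are nonnegative, so the restriction has trace at most 1 and
  \<open>admissible_completion\<close> applies. The result lives on the image in \<open>U\<close>,
  where completions from two summands can be compared.\<close>

lemma admissible_pushforward:
  assumes G: "simple_graph G" and U: "simple_graph U" and p: "induced_embedding p G U"
    and adm: "admissible G \<epsilon>"
    and B: "locally_psd U B" and B1: "(\<Sum>u\<in>verts U. B u u) = 1"
  shows "\<exists>D. psd_on (p ` verts G) D \<and> (\<forall>u\<in>p ` verts G. D u u = B u u + \<epsilon>) \<and>
    (\<forall>u\<in>p ` verts G. \<forall>v\<in>p ` verts G. {u, v} \<in> edges U \<longrightarrow> D u v = B u v)"
proof -
  have inj: "inj p" and sub: "p ` verts G \<subseteq> verts U" and V: "finite (verts U)"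
    using p U by (auto simp: induced_embedding_def simple_graph_def)
  have "(\<Sum>i\<in>verts G. B (p i) (p i)) = (\<Sum>u\<in>p ` verts G. B u u)"
    by (simp add: sum.reindex[OF inj_on_subset[OF inj]])
  also have "\<dots> \<le> 1"
    unfolding B1[symmetric] using V sub locally_psd_diag_nonneg[OF B] by (intro sum_mono2) auto
  finally obtain D where D: "psd_completion G (\<lambda>i j. B (p i) (p j)) \<epsilon> D"
    using admissible_completion[OF G adm locally_psd_pullback[OF p B]] by blast
  let ?D = "\<lambda>u v. D (inv p u) (inv p v)"
  show ?thesis
  proof (intro exI[of _ ?D] conjI ballI impI)
    show "psd_on (p ` verts G) ?D"
      using D inj by (simp add: psd_on_reindex[OF inj_on_subset[OF inj]] psd_completion_def)
    show "?D u u = B u u + \<epsilon>" if "u \<in> p ` verts G" for u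
      using that D inj by (auto simp: psd_completion_def)
    show "?D u v = B u v" if "u \<in> p ` verts G" "v \<in> p ` verts G" "{u, v} \<in> edges U" for u v
      using that D inj p by (auto simp: psd_completion_def induced_embedding_def)
  qed
qed

text \<open>Both sides are completed with the same shift. On the overlap, a clique, all entries are
  prescribed, so the completions agree and \<open>psd_on_glue\<close> joins them.\<close>

lemma admissible_amalgam:
  assumes G: "simple_graph G" and H: "simple_graph H" and U: "simple_graph U"
    and p: "induced_embedding p G U" and q: "induced_embedding q H U"
    and V: "verts U = p ` verts G \<union> q ` verts H"
    and E: "edges U \<subseteq> (`) p ` edges G \<union> (`) q ` edges H"
    and overlap: "clique (p ` verts G \<inter> q ` verts H) (edges U)"
    and admG: "admissible G \<epsilon>" and admH: "admissible H \<epsilon>"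
  shows "admissible U \<epsilon>"
proof -
  let ?S = "p ` verts G" and ?T = "q ` verts H"
  have "\<exists>D. psd_completion U B \<epsilon> D"
    if B: "locally_psd U B" and B1: "(\<Sum>u\<in>verts U. B u u) = 1" for B
  proof -
    obtain D1 where D1: "psd_on ?S D1" "\<forall>u\<in>?S. D1 u u = B u u + \<epsilon>"
      "\<forall>u\<in>?S. \<forall>v\<in>?S. {u, v} \<in> edges U \<longrightarrow> D1 u v = B u v"
      using admissible_pushforward[OF G U p admG B B1] by (elim exE conjE)
    obtain D2 where D2: "psd_on ?T D2" "\<forall>u\<in>?T. D2 u u = B u u + \<epsilon>"
      "\<forall>u\<in>?T. \<forall>v\<in>?T. {u, v} \<in> edges U \<longrightarrow> D2 u v = B u v"
      using admissible_pushforward[OF H U q admH B B1] by (elim exE conjE)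
    have "D1 u v = D2 u v" if "u \<in> ?S \<inter> ?T" "v \<in> ?S \<inter> ?T" for u v
    proof (cases "u = v")
      case True
      then show ?thesis using that D1(2) D2(2) by auto
    next
      case False
      then have "{u, v} \<in> edges U" using that overlap unfolding clique_def by blast
      then have "D1 u v = B u v" "D2 u v = B u v" using that D1(3) D2(3) by blast+
      then show ?thesis by simp
    qed
    moreover have "finite ?S" "finite ?T"
      using G H by (auto simp: simple_graph_def)
    ultimately obtain D where D: "psd_on (?S \<union> ?T) D"
      "\<And>u v. u \<in> ?S \<Longrightarrow> v \<in> ?S \<Longrightarrow> D u v = D1 u v"
      "\<And>u v. u \<in> ?T \<Longrightarrow> v \<in> ?T \<Longrightarrow> D u v = D2 u v"
      using psd_on_glue[of ?S ?T D1 D2] D1(1) D2(1) by metis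
    have "D u v = B u v" if e: "{u, v} \<in> edges U" for u v
    proof -
      \<comment> \<open>No edge crosses between the sides, so every prescribed entry already occurs
        in one of the two completions.\<close>
      have "{u, v} \<subseteq> ?S \<or> {u, v} \<subseteq> ?T"
      proof -
        consider f where "f \<in> edges G" "{u, v} = p ` f" | f where "f \<in> edges H" "{u, v} = q ` f"
          using subsetD[OF E e] by (elim UnE imageE) blast+
        then show ?thesis
        proof cases
          case 1
          then have "f \<subseteq> verts G" using G by (auto simp: simple_graph_def nsets_def)
          then show ?thesis unfolding 1(2) by (simp add: image_mono)
        next
          case 2
          then have "f \<subseteq> verts H" using H by (auto simp: simple_graph_def nsets_def)
          then show ?thesis unfolding 2(2) by (simp add: image_mono)
        qed
      qed
      then show ?thesis using e D(2,3) D1(3) D2(3) by (metis insert_subset)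
    qed
    moreover have "D u u = B u u + \<epsilon>" if "u \<in> verts U" for u
      using that D(2,3) D1(2) D2(2) unfolding V by (metis UnE)
    ultimately have "psd_completion U B \<epsilon> D"
      using D(1) by (simp add: psd_completion_def V)
    then show ?thesis by blast
  qed
  then show ?thesis using admG by (simp add: admissible_def)
qed

section \<open>Clique sums\<close>

text \<open>Injectivity of both maps gives each vertex at most one partner, so a second gluing step
  only leads back to the start.\<close>

lemma equivclp_glued:
  assumes "inj_on \<phi> (verts K)" "inj_on \<psi> (verts K)"
  shows "equivclp (glued K \<phi> \<psi>) u v \<longleftrightarrow> u = v \<or> glued K \<phi> \<psi> u v \<or> glued K \<phi> \<psi> v u"
proof
  assume "equivclp (glued K \<phi> \<psi>) u v"
  then show "u = v \<or> glued K \<phi> \<psi> u v \<or> glued K \<phi> \<psi> v u"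
  proof (induction rule: equivclp_induct)
    case (step y z)
    then show ?case using assms by (auto simp: glued_def dest: inj_onD)
  qed simp
qed (auto intro: equivclp_sym)

lemma glue_class_eq_iff:
  assumes "inj_on \<phi> (verts K)" "inj_on \<psi> (verts K)"
  shows "glue_class K \<phi> \<psi> u = glue_class K \<phi> \<psi> v \<longleftrightarrow>
    u = v \<or> glued K \<phi> \<psi> u v \<or> glued K \<phi> \<psi> v u"
proof -
  have "glue_class K \<phi> \<psi> u = glue_class K \<phi> \<psi> v \<longleftrightarrow> equivclp (glued K \<phi> \<psi>) u v"
    unfolding glue_class_def set_eq_iff mem_Collect_eq
    by (meson equivclp_refl equivclp_sym equivclp_trans)
  then show ?thesis by (simp add: equivclp_glued[OF assms])
qed

text \<open>An edge of \<open>H\<close> whose image lies in the image of \<open>G\<close> has both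
  ends in the overlap, where \<open>G\<close> already supplies an edge; so gluing adds no edge
  inside \<open>G\<close>.\<close>

lemma induced_embedding_amalgam:
  assumes G: "simple_graph G" and H: "simple_graph H" and p: "inj p" and q: "inj q"
    and V: "p ` verts G \<subseteq> verts U"
    and E: "edges U = (`) p ` edges G \<union> (`) q ` edges H"
    and overlap: "clique (p ` verts G \<inter> q ` verts H) ((`) p ` edges G)"
  shows "induced_embedding p G U"
proof -
  have pE: "{p i, p j} \<in> (`) p ` edges G \<longleftrightarrow> {i, j} \<in> edges G" for i j
    using inj_image_eq_iff[OF p, of "{i, j}"] by (simp add: image_iff)
  have "{p i, p j} \<in> (`) p ` edges G"
    if ij: "i \<in> verts G" "j \<in> verts G" and e: "{p i, p j} \<in> (`) q ` edges H" for i j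
  proof -
    obtain f where f: "f \<in> edges H" "{p i, p j} = q ` f" using e by blast
    obtain a b where ab: "f = {a, b}" "a \<noteq> b" "a \<in> verts H" "b \<in> verts H"
      using simple_graph_edgeE[OF H f(1)] .
    \<comment> \<open>A clique only provides edges between distinct vertices, so the ends must be
      known to stay distinct under \<open>q\<close>.\<close>
    have "{p i, p j} = {q a, q b}" "q a \<noteq> q b"
      using f ab q by (auto simp: inj_eq)
    then have "p i \<noteq> p j" "p i \<in> q ` verts H" "p j \<in> q ` verts H"
      using ab by (auto simp: doubleton_eq_iff)
    then show ?thesis using overlap ij unfolding clique_def by blast
  qed
  then show ?thesis using p V by (auto simp: induced_embedding_def E pE)
qed

theorem theorem7:
  fixes G :: "'a ugraph" and H :: "'b ugraph" and K :: "'c ugraph"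
    and \<phi> :: "'c \<Rightarrow> 'a" and \<psi> :: "'c \<Rightarrow> 'b"
  assumes "simple_graph G" and "verts G \<noteq> {}"
    and "simple_graph H" and "verts H \<noteq> {}"
    and "complete_graph K"
    and "graph_hom K G \<phi>" and "inj_on \<phi> (verts K)"
    and "graph_hom K H \<psi>" and "inj_on \<psi> (verts K)"
  shows "conical_distance (clique_sum K \<phi> \<psi> G H) =
    max (conical_distance G) (conical_distance H)"
proof -
  note G = assms(1) and H = assms(3)
  define U where "U = clique_sum K \<phi> \<psi> G H"
  define p where "p a = glue_class K \<phi> \<psi> (Inl a)" for a
  define q where "q b = glue_class K \<phi> \<psi> (Inr b)" for b
  note class_eq = glue_class_eq_iff[OF assms(7,9)]
  \<comment> \<open>Gluing relates only vertices of different summands, so neither quotient map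
    identifies two vertices of its own summand.\<close>
  have p: "inj p" and q: "inj q"
    by (auto intro!: injI simp: p_def q_def class_eq glued_def)
  have pq: "p a = q b \<longleftrightarrow> (\<exists>x\<in>verts K. a = \<phi> x \<and> b = \<psi> x)" for a b
    by (auto simp: p_def q_def class_eq glued_def)
  have V: "verts U = p ` verts G \<union> q ` verts H"
    by (simp add: U_def clique_sum_def Plus_def image_Un image_image p_def q_def)
  have E: "edges U = (`) p ` edges G \<union> (`) q ` edges H"
    by (simp add: U_def clique_sum_def image_image p_def q_def)
  have K: "{\<phi> x, \<phi> y} \<in> edges G \<and> {\<psi> x, \<psi> y} \<in> edges H"
    if "x \<in> verts K" "y \<in> verts K" "x \<noteq> y" for x y
  proof -
    have "{x, y} \<in> edges K" using assms(5) that by (simp add: complete_graph_def nsets_def)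
    then show ?thesis using assms(6,8) by (force simp: graph_hom_def)
  qed
  \<comment> \<open>Overlap points come from vertices of the complete graph \<open>K\<close>, hence
    are adjacent. The edge is found in both summands because the embedding argument is applied to
    each in turn.\<close>
  have overlap: "{u, v} \<in> (`) p ` edges G \<and> {u, v} \<in> (`) q ` edges H"
    if u: "u \<in> p ` verts G \<inter> q ` verts H" and v: "v \<in> p ` verts G \<inter> q ` verts H"
      and "u \<noteq> v" for u v
  proof -
    have glue: "\<exists>x\<in>verts K. w = p (\<phi> x) \<and> w = q (\<psi> x)"
      if w: "w \<in> p ` verts G \<inter> q ` verts H" for w
    proof -
      obtain a b where "w = p a" "w = q b" using w by blast
      then show ?thesis using pq[of a b] by auto
    qed
    obtain x where x: "x \<in> verts K" "u = p (\<phi> x)" "u = q (\<psi> x)" using glue[OF u] by auto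
    obtain y where y: "y \<in> verts K" "v = p (\<phi> y)" "v = q (\<psi> y)" using glue[OF v] by auto
    have "{u, v} = p ` {\<phi> x, \<phi> y}" "{u, v} = q ` {\<psi> x, \<psi> y}" using x y by simp_all
    moreover have "x \<noteq> y" using x y \<open>u \<noteq> v\<close> by auto
    ultimately show ?thesis using K[OF x(1) y(1)] by (metis imageI)
  qed
  have U: "simple_graph U"
  proof -
    have "finite (verts U)" using G H by (simp add: V simple_graph_def)
    moreover have "e \<in> [verts U]\<^bsup>2\<^esup>" if e: "e \<in> edges U" for e
    proof -
      consider f where "f \<in> edges G" "e = p ` f" | f where "f \<in> edges H" "e = q ` f"
        using e unfolding E by (elim UnE imageE) blast+
      then show ?thesis
      proof cases
        case 1
        then show ?thesis
          using simple_graph_edge_image[OF G p] nsets_mono[of "p ` verts G" "verts U" 2] V by blast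
      next
        case 2
        then show ?thesis
          using simple_graph_edge_image[OF H q] nsets_mono[of "q ` verts H" "verts U" 2] V by blast
      qed
    qed
    ultimately show ?thesis by (auto simp: simple_graph_def)
  qed
  have ip: "induced_embedding p G U"
    using overlap by (intro induced_embedding_amalgam[OF G H p q _ E]) (auto simp: V clique_def)
  have iq: "induced_embedding q H U"
    using overlap E by (intro induced_embedding_amalgam[OF H G q p]) (auto simp: V clique_def)
  have "clique (p ` verts G \<inter> q ` verts H) (edges U)"
    unfolding clique_def E by (metis UnI1 overlap)
  then have "admissible U \<epsilon> \<longleftrightarrow> admissible G \<epsilon> \<and> admissible H \<epsilon>" for \<epsilon>
    using admissible_amalgam[OF G H U ip iq V equalityD1[OF E]] admissible_induced[OF G U ip]
      admissible_induced[OF H U iq] by blast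
  \<comment> \<open>It suffices that the two numbers have the same upper bounds.\<close>
  then have "conical_distance U \<le> \<epsilon> \<longleftrightarrow> max (conical_distance G) (conical_distance H) \<le> \<epsilon>" for \<epsilon>
    by (simp add: admissible_iff_conical_distance_le G H U)
  then show ?thesis
    unfolding U_def by (meson order_antisym order_refl)
qed

end
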